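(* Let $(X,d)$ be a compact metric space, let $f_n:X\to X$ be continuous for every $n\ge0$, let $A=(a_{ij})_{N\times N}$ be a transition matrix, and let $\{V_{i,n}\}_{n=0}^\infty$, $1\le i\le N$, be sequences of nonempty closed subsets of $X$ with $V_{i,n}\cap V_{j,n}=\emptyset$ for all $1\le i\ne j\le N$ and $n\ge0$. For $\alpha=(a_0,a_1,\dots)\in\Sigma_N^+(A)$ put $V_\alpha^{m,n}:=\bigcap_{k=0}^{m}f_n^{-k}(V_{a_k,n+k})$. Assume that $V_\alpha^{m,n}\ne\emptyset$ for all $m,n\ge0$ and all $\alpha\in\Sigma_N^+(A)$, and that the diameter $d(V_\alpha^{m,n})$ converges to $0$ as $m\to\infty$ for any $n\ge0$ and any $\alpha\in\Sigma_N^+(A)$. Then for every $n\ge0$ there exists a nonempty compact subset $\mathcal C_n\subset\bigcup_{i=1}^N\langle V_{i,n}\rangle$ of $\mathcal K(X)$ with $\bar f_n(\mathcal C_n)=\mathcal C_{n+1}$ such that the invariant subsystem of the induced set-valued system $A_{n+1}=\bar f_n(A_n)$ on $\{\mathcal C_n\}_{n=0}^\infty$ is topologically conjugate to $(\Sigma_N^+(A),\sigma_A)$.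
   Context: Notation: $f_i^n:=f_{i+n-1}\circ\cdots\circ f_i$ for $n\ge1$, $f_i^0$ is the identity, and $f_i^{-n}:=(f_i^n)^{-1}$ (preimage). $d(B)$ is the diameter of $B\subset X$. $\mathcal K(X)$ is the set of all nonempty compact subsets of $X$ with the Hausdorff metric $\mathcal H_d(B,C):=\max\{\sup_{b\in B}d(b,C),\sup_{c\in C}d(c,B)\}$. For nonempty $K\subset X$, $\langle K\rangle:=\{B\in\mathcal K(X):B\subset K\}$; $\bar f_n:\mathcal K(X)\to\mathcal K(X)$ is $\bar f_n(B):=f_n(B)$. In $\bar f_n(\mathcal C_n)$ the map $\bar f_n$ is applied elementwise: $\bar f_n(\mathcal C_n)=\{\bar f_n(B):B\in\mathcal C_n\}$. A transition matrix is a matrix $A=(a_{ij})_{N\times N}$, $N\ge2$, with $a_{ij}\in\{0,1\}$, $\sum_{j=1}^N a_{ij}\ge1$ for all $i$ and $\sum_{i=1}^N a_{ij}\ge1$ for all $j$. $\Sigma_N^+(A):=\{s=(s_0,s_1,\dots):1\le s_j\le N,\ a_{s_js_{j+1}}=1,\ j\ge0\}$, with metric $\hat\rho(\alpha,\beta):=\sum_{i=0}^\infty \hat d(a_i,b_i)/2^i$ for $\alpha=(a_0,a_1,\dots)$, $\beta=(b_0,b_1,\dots)$, where $\hat d(a,b)=0$ if $a=b$ and $1$ otherwise. $\sigma_A:\Sigma_N^+(A)\to\Sigma_N^+(A)$, $\sigma_A((s_0,s_1,s_2,\dots)):=(s_1,s_2,\dots)$. For subsets $\mathcal C_n\subset\mathcal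 K(X)$ with $\bar f_n(\mathcal C_n)\subset\mathcal C_{n+1}$ for all $n\ge0$, the set-valued system restricted to $\{\mathcal C_n\}$ is called its invariant subsystem on $\{\mathcal C_n\}_{n=0}^\infty$. It is topologically conjugate to $(\Sigma_N^+(A),\sigma_A)$ if for every $n\ge0$ there is a continuous bijection $h_n:\mathcal C_n\to\Sigma_N^+(A)$ with continuous inverse such that $h_{n+1}\circ\bar f_n=\sigma_A\circ h_n$ on $\mathcal C_n$. *)

theory Defs
  imports "HOL-Analysis.Analysis"
begin

text \<open>\<open>nds_iter f i n\<close> is $f_i^n = f_{i+n-1} \circ \cdots \circ f_i$; the preimage map $f_i^{-n}$ is
  \<open>vimage (nds_iter f i n)\<close>.\<close>

primrec nds_iter :: "(nat \<Rightarrow> 'a \<Rightarrow> 'a) \<Rightarrow> nat \<Rightarrow> nat \<Rightarrow> 'a \<Rightarrow> 'a" where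
  "nds_iter f i 0 = id"
| "nds_iter f i (Suc n) = f (i + n) \<circ> nds_iter f i n"

text \<open>\<open>V i n\<close> stands for $V_{i,n}$, and \<open>itinerary_set f V \<alpha> m n\<close> for $V_\alpha^{m,n}$.\<close>

definition itinerary_set ::
    "(nat \<Rightarrow> 'a \<Rightarrow> 'a) \<Rightarrow> (nat \<Rightarrow> nat \<Rightarrow> 'a set) \<Rightarrow> (nat \<Rightarrow> nat) \<Rightarrow> nat \<Rightarrow> nat \<Rightarrow> 'a set" where
  "itinerary_set f V \<alpha> m n = (\<Inter>k\<in>{0..m}. nds_iter f n k -` V (\<alpha> k) (n + k))"

definition hyperspace :: "'a::metric_space set set" where
  "hyperspace = {B. B \<noteq> {} \<and> compact B}"

definition hyper_below :: "'a::metric_space set \<Rightarrow> 'a set set" where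
  "hyper_below K = {B \<in> hyperspace. B \<subseteq> K}"

text \<open>The locale \<open>Metric_space\<close> requires nonnegativity also off the carrier, where the suprema may
  be meaningless; hence the default value \<open>0\<close> there.\<close>

definition hausdorff_dist :: "'a::metric_space set \<Rightarrow> 'a set \<Rightarrow> real" where
  "hausdorff_dist B C =
     (if B \<in> hyperspace \<and> C \<in> hyperspace
      then max (SUP b\<in>B. infdist b C) (SUP c\<in>C. infdist c B) else 0)"

lemma hyperspace_infdist_bdd:
  assumes "B \<in> hyperspace"
  shows "bdd_above ((\<lambda>b. infdist b C) ` B)"
proof -
  have "compact ((\<lambda>b. infdist b C) ` B)"
    using assms by (intro compact_continuous_image continuous_intros) (auto simp: hyperspace_def)
  then show ?thesis
    by (simp add: bounded_imp_bdd_above compact_imp_bounded)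
qed

lemma infdist_le_hausdorff_dist:
  assumes "B \<in> hyperspace" "C \<in> hyperspace" "b \<in> B"
  shows "infdist b C \<le> hausdorff_dist B C"
  using cSUP_upper[OF assms(3) hyperspace_infdist_bdd[OF assms(1)], of C] assms
  by (auto simp: hausdorff_dist_def max_def)

lemma hausdorff_dist_le:
  assumes "B \<in> hyperspace" "C \<in> hyperspace"
    and "\<And>b. b \<in> B \<Longrightarrow> infdist b C \<le> r" "\<And>c. c \<in> C \<Longrightarrow> infdist c B \<le> r"
  shows "hausdorff_dist B C \<le> r"
  using assms by (auto simp: hausdorff_dist_def hyperspace_def intro!: cSUP_least)

lemma hausdorff_dist_commute: "hausdorff_dist B C = hausdorff_dist C B"
  by (auto simp: hausdorff_dist_def max.commute)

lemma infdist_hausdorff_triangle: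
  assumes "B \<in> hyperspace" "C \<in> hyperspace" "D \<in> hyperspace" "b \<in> B"
  shows "infdist b D \<le> hausdorff_dist B C + hausdorff_dist C D"
proof -
  have "infdist b D - hausdorff_dist C D \<le> dist b c" if "c \<in> C" for c
    using infdist_triangle[of b D c] infdist_le_hausdorff_dist[OF assms(2,3) that] by simp
  moreover have "C \<noteq> {}"
    using assms by (auto simp: hyperspace_def)
  ultimately have "infdist b D - hausdorff_dist C D \<le> infdist b C"
    by (auto simp: infdist_notempty intro!: cINF_greatest)
  then show ?thesis
    using infdist_le_hausdorff_dist[OF assms(1,2,4)] by simp
qed

lemma Metric_space_hyperspace: "Metric_space hyperspace hausdorff_dist"
proof
  fix B C D :: "'a set"
  show "0 \<le> hausdorff_dist B C"
  proof (cases "B \<in> hyperspace \<and> C \<in> hyperspace")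
    case True
    then obtain b where "b \<in> B" by (auto simp: hyperspace_def)
    with True show ?thesis
      using infdist_le_hausdorff_dist[of B C b] infdist_nonneg[of b C] by auto
  qed (auto simp: hausdorff_dist_def)
  show "hausdorff_dist B C = hausdorff_dist C B"
    by (rule hausdorff_dist_commute)
  show "hausdorff_dist B C = 0 \<longleftrightarrow> B = C" if BC: "B \<in> hyperspace" "C \<in> hyperspace"
  proof
    have sub: "B' \<subseteq> C'" if "hausdorff_dist B' C' = 0" "B' \<in> hyperspace" "C' \<in> hyperspace"
      for B' C' :: "'a set"
    proof
      fix b assume "b \<in> B'"
      then have "infdist b C' = 0"
        using infdist_le_hausdorff_dist[OF that(2,3)] that(1) infdist_nonneg[of b C'] by fastforce
      then show "b \<in> C'"
        using that(3) by (auto simp: hyperspace_def in_closed_iff_infdist_zero compact_imp_closed)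
    qed
    assume "hausdorff_dist B C = 0"
    with sub[of B C] sub[of C B] BC show "B = C"
      by (simp add: hausdorff_dist_commute)
  next
    assume "B = C"
    with BC show "hausdorff_dist B C = 0"
      by (auto simp: hausdorff_dist_def hyperspace_def)
  qed
  show "hausdorff_dist B D \<le> hausdorff_dist B C + hausdorff_dist C D"
    if h: "B \<in> hyperspace" "C \<in> hyperspace" "D \<in> hyperspace"
  proof (rule hausdorff_dist_le)
    show "infdist d B \<le> hausdorff_dist B C + hausdorff_dist C D" if "d \<in> D" for d
      using infdist_hausdorff_triangle[OF h(3,2,1) that] by (simp add: hausdorff_dist_commute)
  qed (use h infdist_hausdorff_triangle in auto)
qed

definition hyperspace_topology :: "'a::metric_space set topology" where
  "hyperspace_topology = Metric_space.mtopology hyperspace hausdorff_dist"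

definition induced_map :: "(nat \<Rightarrow> 'a \<Rightarrow> 'a) \<Rightarrow> nat \<Rightarrow> 'a set \<Rightarrow> 'a set" where
  "induced_map f n B = f n ` B"

text \<open>Matrices are indexed by \<open>{1..N}\<close>; entries outside this range are irrelevant.\<close>

definition transition_matrix :: "nat \<Rightarrow> (nat \<Rightarrow> nat \<Rightarrow> nat) \<Rightarrow> bool" where
  "transition_matrix N A \<longleftrightarrow>
     N \<ge> 2 \<and>
     (\<forall>i\<in>{1..N}. \<forall>j\<in>{1..N}. A i j \<in> {0, 1}) \<and>
     (\<forall>i\<in>{1..N}. (\<Sum>j=1..N. A i j) \<ge> 1) \<and>
     (\<forall>j\<in>{1..N}. (\<Sum>i=1..N. A i j) \<ge> 1)"

definition subshift :: "nat \<Rightarrow> (nat \<Rightarrow> nat \<Rightarrow> nat) \<Rightarrow> (nat \<Rightarrow> nat) set" where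
  "subshift N A = {s. \<forall>j. s j \<in> {1..N} \<and> A (s j) (s (Suc j)) = 1}"

definition seq_dist :: "(nat \<Rightarrow> nat) \<Rightarrow> (nat \<Rightarrow> nat) \<Rightarrow> real" where
  "seq_dist \<alpha> \<beta> = (\<Sum>i. (if \<alpha> i = \<beta> i then 0 else 1) / 2 ^ i)"

lemma summable_seq_dist: "summable (\<lambda>i. (if \<alpha> i = \<beta> i then 0 else 1) / 2 ^ i :: real)"
proof (rule summable_comparison_test')
  show "summable (\<lambda>i. (1 / 2) ^ i :: real)" by simp
qed (auto simp: power_one_over)

lemma Metric_space_subshift: "Metric_space (subshift N A) seq_dist"
proof
  fix \<alpha> \<beta> \<gamma> :: "nat \<Rightarrow> nat"
  show "0 \<le> seq_dist \<alpha> \<beta>"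
    unfolding seq_dist_def by (intro suminf_nonneg summable_seq_dist) auto
  show "seq_dist \<alpha> \<beta> = seq_dist \<beta> \<alpha>"
    unfolding seq_dist_def by (simp add: eq_commute)
  show "seq_dist \<alpha> \<beta> = 0 \<longleftrightarrow> \<alpha> = \<beta>"
    unfolding seq_dist_def by (subst suminf_eq_zero_iff[OF summable_seq_dist]) auto
  show "seq_dist \<alpha> \<gamma> \<le> seq_dist \<alpha> \<beta> + seq_dist \<beta> \<gamma>"
    unfolding seq_dist_def suminf_add[OF summable_seq_dist summable_seq_dist]
    by (intro suminf_le summable_add summable_seq_dist) auto
qed

definition subshift_topology :: "nat \<Rightarrow> (nat \<Rightarrow> nat \<Rightarrow> nat) \<Rightarrow> (nat \<Rightarrow> nat) topology" where
  "subshift_topology N A = Metric_space.mtopology (subshift N A) seq_dist"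

definition shift :: "(nat \<Rightarrow> nat) \<Rightarrow> nat \<Rightarrow> nat" where
  "shift s = (\<lambda>j. s (Suc j))"

definition invariant_subsystem ::
    "(nat \<Rightarrow> 'a::metric_space \<Rightarrow> 'a) \<Rightarrow> (nat \<Rightarrow> 'a set set) \<Rightarrow> bool" where
  "invariant_subsystem f C \<longleftrightarrow>
     (\<forall>n. C n \<subseteq> hyperspace \<and> induced_map f n ` C n \<subseteq> C (Suc n))"

definition conjugate_to_subshift ::
    "(nat \<Rightarrow> 'a::metric_space \<Rightarrow> 'a) \<Rightarrow> (nat \<Rightarrow> 'a set set) \<Rightarrow> nat \<Rightarrow> (nat \<Rightarrow> nat \<Rightarrow> nat) \<Rightarrow> bool" where
  "conjugate_to_subshift f C N A \<longleftrightarrow>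
     (\<exists>h. \<forall>n. homeomorphic_map (subtopology hyperspace_topology (C n)) (subshift_topology N A) (h n) \<and>
              (\<forall>B\<in>C n. h (Suc n) (induced_map f n B) = shift (h n B)))"

end

theory Submission
  imports Defs
begin

text \<open>Under the hypotheses each \<open>\<alpha>\<close> has at every time \<open>n\<close> exactly one point \<open>x n \<alpha>\<close> whose orbit
  follows the itinerary \<open>\<alpha>\<close>, so \<open>f n (x n \<alpha>) = x (Suc n) (shift \<alpha>)\<close>, and \<open>C n\<close> can be taken to
  consist of the singletons \<open>{x n \<alpha>}\<close>. The map \<open>\<alpha> \<mapsto> {x n \<alpha>}\<close> is injective by disjointness of the
  \<open>V i n\<close> and continuous by the shrinking diameters; since the subshift is compact, it is a
  homeomorphism onto \<open>C n\<close>, and its inverse is the conjugacy.\<close>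

section \<open>Itinerary sets and the point that an itinerary determines\<close>

lemma nds_iter_Suc_right: "nds_iter f n (Suc k) = nds_iter f (Suc n) k \<circ> f n"
proof (induction k)
  case (Suc k)
  show ?case
    using Suc by (simp only: nds_iter.simps(2)[of f _ "Suc k"] nds_iter.simps(2)[of f "Suc n" k])
      (simp add: comp_assoc)
qed simp

lemma continuous_on_nds_iter:
  fixes f :: "nat \<Rightarrow> 'a::topological_space \<Rightarrow> 'a"
  assumes "\<And>n. continuous_on UNIV (f n)"
  shows "continuous_on UNIV (nds_iter f n k)"
proof (induction k)
  case (Suc k)
  then show ?case
    using continuous_on_compose[OF Suc continuous_on_subset[OF assms]] by simp
qed (simp add: id_def)

lemma itinerary_set_antimono: "m \<le> m' \<Longrightarrow> itinerary_set f V \<alpha> m' n \<subseteq> itinerary_set f V \<alpha> m n"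
  by (auto simp: itinerary_set_def)

lemma mem_all_itinerary_sets_iff:
  "(\<forall>m. y \<in> itinerary_set f V \<alpha> m n) \<longleftrightarrow> (\<forall>k. nds_iter f n k y \<in> V (\<alpha> k) (n + k))"
  by (fastforce simp: itinerary_set_def)

lemma itinerary_set_cong:
  "(\<And>k. k \<le> m \<Longrightarrow> \<alpha> k = \<beta> k) \<Longrightarrow> itinerary_set f V \<alpha> m n = itinerary_set f V \<beta> m n"
  by (auto simp: itinerary_set_def)

lemma closed_itinerary_set:
  fixes f :: "nat \<Rightarrow> 'a::topological_space \<Rightarrow> 'a"
  assumes "\<And>n. continuous_on UNIV (f n)" and "\<And>k. closed (V (\<alpha> k) (n + k))"
  shows "closed (itinerary_set f V \<alpha> m n)"
  unfolding itinerary_set_def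
  by (intro closed_INT ballI closed_vimage assms continuous_on_nds_iter)

text \<open>Existence is Cantor's intersection theorem for a decreasing sequence of nonempty compact
  sets. Uniqueness holds because two common points are no further apart than any of the diameters,
  which tend to 0.\<close>

lemma ex1_itinerary_point:
  fixes f :: "nat \<Rightarrow> 'a::metric_space \<Rightarrow> 'a"
  assumes "compact (UNIV :: 'a set)" and "\<And>n. continuous_on UNIV (f n)"
    and "\<And>k. closed (V (\<alpha> k) (n + k))"
    and "\<And>m. itinerary_set f V \<alpha> m n \<noteq> {}"
    and lim: "(\<lambda>m. diameter (itinerary_set f V \<alpha> m n)) \<longlonglongrightarrow> 0"
  shows "\<exists>!x. \<forall>m. x \<in> itinerary_set f V \<alpha> m n"
proof -
  let ?I = "\<lambda>m. itinerary_set f V \<alpha> m n"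
  have clos: "closed (?I m)" for m
    by (intro closed_itinerary_set assms(2,3))
  have cpt: "compact (?I m)" for m
    using compact_Int_closed[OF assms(1) clos] by simp
  have "\<Inter>(range ?I) \<noteq> {}"
    using compact_space_imp_nest[of euclidean ?I] assms(1,4) clos
    by (simp add: compact_space_def decseq_def itinerary_set_antimono)
  moreover have "x = y" if "\<forall>m. x \<in> ?I m" "\<forall>m. y \<in> ?I m" for x y
  proof -
    have "dist x y \<le> diameter (?I m)" for m
      using that by (intro diameter_bounded_bound compact_imp_bounded cpt) auto
    then have "dist x y \<le> 0"
      using lim by (intro LIMSEQ_le_const) auto
    then show ?thesis by simp
  qed
  ultimately show ?thesis by blast
qed

section \<open>The sequence metric and compactness of the subshift\<close>

lemma seq_dist_less_imp_eq:
  assumes "seq_dist \<alpha> \<beta> < 1 / 2 ^ m" "i \<le> m"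
  shows "\<alpha> i = \<beta> i"
proof (rule ccontr)
  assume "\<alpha> i \<noteq> \<beta> i"
  let ?t = "\<lambda>i. (if \<alpha> i = \<beta> i then 0 else 1) / 2 ^ i :: real"
  \<comment> \<open>The terms are nonnegative, so the single mismatch at \<open>i\<close> bounds the
    whole series from below.\<close>
  have "?t i \<le> seq_dist \<alpha> \<beta>"
    unfolding seq_dist_def
    using sum_le_suminf[OF summable_seq_dist, of "{i}" \<alpha> \<beta>] by simp
  moreover have "(1::real) / 2 ^ m \<le> 1 / 2 ^ i"
    using assms(2) by (simp add: frac_le power_increasing)
  ultimately show False
    using assms(1) \<open>\<alpha> i \<noteq> \<beta> i\<close> by simp
qed

text \<open>The first \<open>m\<close> terms vanish and the tail is dominated by a geometric
  series.\<close>

lemma seq_dist_le: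
  assumes "\<And>i. i < m \<Longrightarrow> \<alpha> i = \<beta> i"
  shows "seq_dist \<alpha> \<beta> \<le> 2 * (1 / 2) ^ m"
proof -
  let ?t = "\<lambda>i. (if \<alpha> i = \<beta> i then 0 else 1) / 2 ^ i :: real"
  have "seq_dist \<alpha> \<beta> = (\<Sum>i. ?t (i + m))"
    unfolding seq_dist_def
    by (subst suminf_split_initial_segment[OF summable_seq_dist, of _ _ m]) (simp add: assms)
  also have "\<dots> \<le> (\<Sum>i. (1 / 2) ^ m * (1 / 2) ^ i)"
    by (intro suminf_le summable_mult summable_geometric
        summable_ignore_initial_segment[OF summable_seq_dist])
      (auto simp: power_add power_one_over mult.commute)
  also have "\<dots> = 2 * (1 / 2) ^ m"
    by (subst suminf_mult) (auto simp: suminf_geometric)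
  finally show ?thesis .
qed

lemma topspace_subshift_topology [simp]: "topspace (subshift_topology N A) = subshift N A"
  by (simp add: subshift_topology_def Metric_space.topspace_mtopology[OF Metric_space_subshift])

text \<open>This is compactness in the product topology on \<open>nat \<Rightarrow> nat\<close>: by
  Tychonoff the sequences over the finite alphabet form a compact set, and each transition condition
  cuts out a closed subset.\<close>

lemma compact_subshift: "compact (subshift N A)"
proof -
  have eval: "continuous_on UNIV (\<lambda>s::nat \<Rightarrow> nat. s j)" for j
    by (rule continuous_on_product_coordinates)
  have "compactin (product_topology (\<lambda>_. euclidean) UNIV) (\<Pi>\<^sub>E j\<in>(UNIV :: nat set). {1..N})"
    by (auto simp: compactin_PiE intro: finite_imp_compact)
  then have "compact (\<Pi>\<^sub>E j\<in>(UNIV :: nat set). {1..N})"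
    by (simp add: euclidean_product_topology)
  moreover have "closed {s :: nat \<Rightarrow> nat. A (s j) (s (Suc j)) = 1}" for j
  proof -
    \<comment> \<open>A forbidden transition at place \<open>j\<close> is seen in two coordinates,
      so the complement is a union of cylinders, which are open since symbols are discrete.\<close>
    have "- {s :: nat \<Rightarrow> nat. A (s j) (s (Suc j)) = 1}
        = (\<Union>(a, b)\<in>{(a, b). A a b \<noteq> 1}. (\<lambda>s. s j) -` {a} \<inter> (\<lambda>s. s (Suc j)) -` {b})"
      by auto
    moreover have "open \<dots>"
      by (auto intro!: open_UN open_Int open_vimage eval open_discrete)
    ultimately show ?thesis by (simp add: closed_def)
  qed
  moreover have "subshift N A
      = (\<Pi>\<^sub>E j\<in>(UNIV :: nat set). {1..N}) \<inter> (\<Inter>j. {s. A (s j) (s (Suc j)) = 1})"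
    by (auto simp: subshift_def PiE_def Pi_def)
  ultimately show ?thesis
    by (auto intro!: compact_Int_closed closed_INT)
qed

text \<open>Compactness passes from the product topology to the topology of \<open>seq_dist\<close>
  along the identity, which is continuous because agreement on a long initial block makes
  \<open>seq_dist\<close> small.\<close>

lemma compact_space_subshift_topology: "compact_space (subshift_topology N A)"
proof -
  interpret Metric_space "subshift N A" seq_dist
    by (rule Metric_space_subshift)
  have "continuous_map (top_of_set (subshift N A)) (subshift_topology N A) (\<lambda>s. s)"
    unfolding subshift_topology_def continuous_map_to_metric
  proof (intro ballI allI impI)
    fix \<alpha> and e :: real
    assume \<alpha>: "\<alpha> \<in> topspace (top_of_set (subshift N A))" and "0 < e"
    then obtain m where m: "(1 / 2) ^ m < e / 2"
      using real_arch_pow_inv[of "e / 2" "1 / 2"] by auto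
    let ?U = "\<Inter>i<m. (\<lambda>s :: nat \<Rightarrow> nat. s i) -` {\<alpha> i}"
    have "open ?U"
      by (intro open_INT ballI open_vimage continuous_on_product_coordinates open_discrete) auto
    moreover have "seq_dist \<alpha> \<beta> < e" if "\<beta> \<in> ?U" for \<beta>
      using seq_dist_le[of m \<alpha> \<beta>] that m by auto
    ultimately show "\<exists>U. openin (top_of_set (subshift N A)) U \<and> \<alpha> \<in> U \<and> (\<forall>\<beta>\<in>U. \<beta> \<in> mball \<alpha> e)"
      using \<alpha> by (intro exI[of _ "subshift N A \<inter> ?U"]) (auto simp: openin_open_Int)
  qed
  moreover have "compactin (top_of_set (subshift N A)) (subshift N A)"
    by (simp add: compactin_subtopology compact_subshift)
  ultimately show ?thesis
    using image_compactin by (fastforce simp: compact_space_def)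
qed

section \<open>Consequences of the row and column sum conditions\<close>

lemma subshift_nonempty:
  assumes "transition_matrix N A"
  shows "subshift N A \<noteq> {}"
proof -
  have "\<exists>j\<in>{1..N}. A i j = 1" if "i \<in> {1..N}" for i
  proof (rule ccontr)
    assume "\<not> ?thesis"
    then have "\<forall>j\<in>{1..N}. A i j = 0"
      using assms that by (fastforce simp: transition_matrix_def)
    then have "(\<Sum>j=1..N. A i j) = 0" by simp
    moreover have "(\<Sum>j=1..N. A i j) \<ge> 1"
      using assms that unfolding transition_matrix_def by blast
    ultimately show False by simp
  qed
  \<comment> \<open>\<open>g\<close> selects an admissible successor of each symbol; iterating it
    from the symbol 1 gives a point of the subshift.\<close>
  then obtain g where g: "\<And>i. i \<in> {1..N} \<Longrightarrow> g i \<in> {1..N} \<and> A i (g i) = 1"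
    by metis
  have "(g ^^ k) 1 \<in> {1..N}" for k
    using assms by (induction k) (use g in \<open>auto simp: transition_matrix_def\<close>)
  then have "(\<lambda>k. (g ^^ k) 1) \<in> subshift N A"
    using g by (auto simp: subshift_def)
  then show ?thesis by blast
qed

lemma shift_image_subshift:
  assumes "transition_matrix N A"
  shows "shift ` subshift N A = subshift N A"
proof (intro equalityI subsetI)
  fix \<beta> assume \<beta>: "\<beta> \<in> subshift N A"
  then have b0: "\<beta> 0 \<in> {1..N}"
    by (simp add: subshift_def)
  have "\<exists>i\<in>{1..N}. A i (\<beta> 0) = 1"
  proof (rule ccontr)
    assume "\<not> ?thesis"
    then have "\<forall>i\<in>{1..N}. A i (\<beta> 0) = 0"
      using assms b0 by (fastforce simp: transition_matrix_def)
    then have "(\<Sum>i=1..N. A i (\<beta> 0)) = 0" by simp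
    moreover have "(\<Sum>i=1..N. A i (\<beta> 0)) \<ge> 1"
      using assms b0 unfolding transition_matrix_def by blast
    ultimately show False by simp
  qed
  then obtain i where "i \<in> {1..N}" "A i (\<beta> 0) = 1" ..
  with \<beta> have "case_nat i \<beta> \<in> subshift N A"
    by (auto simp: subshift_def split: nat.split)
  moreover have "\<beta> = shift (case_nat i \<beta>)"
    by (simp add: shift_def)
  ultimately show "\<beta> \<in> shift ` subshift N A" by blast
qed (auto simp: subshift_def shift_def)

lemma singleton_in_hyperspace [simp]: "{x} \<in> hyperspace"
  by (simp add: hyperspace_def)

text \<open>Passing to singletons is isometric, so estimates in the hyperspace reduce to estimates
  between points.\<close>

lemma hausdorff_dist_singletons: "hausdorff_dist {x} {y} = dist x y"
  by (simp add: hausdorff_dist_def dist_commute)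

section \<open>The invariant family of singletons and its conjugacy with the subshift\<close>

theorem theorem4p3:
  fixes f :: "nat \<Rightarrow> 'a::metric_space \<Rightarrow> 'a"
    and V :: "nat \<Rightarrow> nat \<Rightarrow> 'a set"
    and N :: nat and A :: "nat \<Rightarrow> nat \<Rightarrow> nat"
  assumes "compact (UNIV :: 'a set)"
    and "\<And>n. continuous_on UNIV (f n)"
    and "transition_matrix N A"
    and "\<And>i n. i \<in> {1..N} \<Longrightarrow> V i n \<noteq> {} \<and> closed (V i n)"
    and "\<And>i j n. i \<in> {1..N} \<Longrightarrow> j \<in> {1..N} \<Longrightarrow> i \<noteq> j \<Longrightarrow> V i n \<inter> V j n = {}"
    and "\<And>m n \<alpha>. \<alpha> \<in> subshift N A \<Longrightarrow> itinerary_set f V \<alpha> m n \<noteq> {}"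
    and "\<And>n \<alpha>. \<alpha> \<in> subshift N A \<Longrightarrow> (\<lambda>m. diameter (itinerary_set f V \<alpha> m n)) \<longlonglongrightarrow> 0"
  shows "\<exists>C :: nat \<Rightarrow> 'a set set.
           (\<forall>n. C n \<noteq> {} \<and> compactin hyperspace_topology (C n) \<and>
                C n \<subseteq> (\<Union>i\<in>{1..N}. hyper_below (V i n)) \<and>
                induced_map f n ` C n = C (Suc n)) \<and>
           invariant_subsystem f C \<and>
           conjugate_to_subshift f C N A"
proof -
  note cpt = assms(1) and f = assms(2) and A = assms(3) and V = assms(4) and disj = assms(5)
    and ne = assms(6) and lim = assms(7)
  let ?S = "subshift N A" and ?I = "itinerary_set f V"
  have sym: "\<alpha> k \<in> {1..N}" if "\<alpha> \<in> ?S" for \<alpha> k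
    using that by (simp add: subshift_def)
  have ex1: "\<exists>!x. \<forall>m. x \<in> ?I \<alpha> m n" if "\<alpha> \<in> ?S" for \<alpha> n
    using V sym[OF that] by (intro ex1_itinerary_point cpt f ne lim that) auto
  define x where "x n \<alpha> = (THE y. \<forall>m. y \<in> ?I \<alpha> m n)" for n \<alpha>
  have x: "x n \<alpha> \<in> ?I \<alpha> m n" if "\<alpha> \<in> ?S" for \<alpha> n m
    using theI'[OF ex1[OF that, of n]] unfolding x_def by blast
  have x_unique: "y = x n \<alpha>" if "\<alpha> \<in> ?S" "\<And>m. y \<in> ?I \<alpha> m n" for \<alpha> n y
    using ex1[OF that(1)] that x by blast
  have orbit: "nds_iter f n k (x n \<alpha>) \<in> V (\<alpha> k) (n + k)" if "\<alpha> \<in> ?S" for \<alpha> n k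
    using x[OF that] mem_all_itinerary_sets_iff by metis
  have shift_in: "shift \<alpha> \<in> ?S" if "\<alpha> \<in> ?S" for \<alpha>
    using shift_image_subshift[OF A] that by blast
  have step: "f n (x n \<alpha>) = x (Suc n) (shift \<alpha>)" if "\<alpha> \<in> ?S" for \<alpha> n
  \<comment> \<open>By uniqueness it suffices that \<open>f n (x n \<alpha>)\<close> follows
    \<open>shift \<alpha>\<close> from time \<open>Suc n\<close>; splitting off the first map of the
    iterate instead of the last shows this.\<close>
  proof (rule x_unique[OF shift_in[OF that]])
    have "nds_iter f (Suc n) k (f n (x n \<alpha>)) \<in> V (shift \<alpha> k) (Suc n + k)" for k
      using orbit[OF that, of n "Suc k"] unfolding nds_iter_Suc_right by (simp add: shift_def)
    then show "f n (x n \<alpha>) \<in> ?I (shift \<alpha>) m (Suc n)" for m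
      using mem_all_itinerary_sets_iff by metis
  qed
  have inj: "inj_on (x n) ?S" for n
  proof (rule inj_onI)
    fix \<alpha> \<beta> assume *: "\<alpha> \<in> ?S" "\<beta> \<in> ?S" "x n \<alpha> = x n \<beta>"
    \<comment> \<open>The common orbit lies at time \<open>n + k\<close> in the sets of both
      symbols, and sets of distinct symbols are disjoint.\<close>
    have "\<alpha> k = \<beta> k" for k
      using orbit[OF *(1), of n k] orbit[OF *(2), of n k] *(3) disj[OF sym[OF *(1)] sym[OF *(2)]]
      by auto
    then show "\<alpha> = \<beta>" by auto
  qed
  let ?g = "\<lambda>n \<alpha>. {x n \<alpha>}"
  define C where "C n = ?g n ` ?S" for n
  interpret S: Metric_space ?S seq_dist by (rule Metric_space_subshift)
  interpret H: Metric_space "hyperspace :: 'a set set" hausdorff_dist by (rule Metric_space_hyperspace)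
  have cont: "continuous_map (subshift_topology N A) hyperspace_topology (?g n)" for n
    unfolding hyperspace_topology_def H.continuous_map_to_metric
  proof (intro ballI allI impI)
    fix \<alpha> and e :: real
    assume "\<alpha> \<in> topspace (subshift_topology N A)" and "0 < e"
    then have \<alpha>: "\<alpha> \<in> ?S" by simp
    have "\<forall>\<^sub>F m in sequentially. diameter (?I \<alpha> m n) < e"
      using order_tendstoD(2)[OF lim[OF \<alpha>] \<open>0 < e\<close>] .
    then obtain m where m: "diameter (?I \<alpha> m n) < e"
      by (auto simp: eventually_sequentially)
    \<comment> \<open>This radius forces agreement at the indices 0 to \<open>m\<close>, exactly the
      symbols on which \<open>?I \<alpha> m n\<close> depends. Both points then lie in that one set
      of diameter below \<open>e\<close>.\<close>
    have "?g n \<beta> \<in> H.mball (?g n \<alpha>) e" if "\<beta> \<in> S.mball \<alpha> (1 / 2 ^ m)" for \<beta>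
    proof -
      have \<beta>: "\<beta> \<in> ?S" and "seq_dist \<alpha> \<beta> < 1 / 2 ^ m"
        using that by auto
      then have "?I \<beta> m n = ?I \<alpha> m n"
        using seq_dist_less_imp_eq by (intro itinerary_set_cong) metis
      then have "x n \<beta> \<in> ?I \<alpha> m n"
        using x[OF \<beta>] by metis
      then have "dist (x n \<alpha>) (x n \<beta>) \<le> diameter (?I \<alpha> m n)"
        using x[OF \<alpha>] bounded_subset[OF compact_imp_bounded[OF cpt]]
        by (intro diameter_bounded_bound) auto
      with m show ?thesis
        by (simp add: hausdorff_dist_singletons)
    qed
    then show "\<exists>U. openin (subshift_topology N A) U \<and> \<alpha> \<in> U \<and> (\<forall>\<beta>\<in>U. ?g n \<beta> \<in> H.mball (?g n \<alpha>) e)"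
      unfolding subshift_topology_def
      by (intro exI[of _ "S.mball \<alpha> (1 / 2 ^ m)"]) (use \<alpha> in auto)
  qed
  have C_sub: "C n \<subseteq> hyperspace" for n
    by (auto simp: C_def)
  have g_inj: "inj_on (?g n) ?S" for n
    using inj[of n] by (auto simp: inj_on_def)
  have homeo: "homeomorphic_map (subshift_topology N A) (subtopology hyperspace_topology (C n)) (?g n)"
    for n
  \<comment> \<open>A continuous bijection from a compact space onto a Hausdorff space has a
    continuous inverse, so no direct estimate for the inverse is required.\<close>
  proof (rule continuous_imp_homeomorphic_map)
    show "compact_space (subshift_topology N A)"
      by (rule compact_space_subshift_topology)
    show "Hausdorff_space (subtopology hyperspace_topology (C n))"
      unfolding hyperspace_topology_def by (intro Hausdorff_space_subtopology H.Hausdorff_space_mtopology)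
    show "continuous_map (subshift_topology N A) (subtopology hyperspace_topology (C n)) (?g n)"
      using cont by (auto simp: continuous_map_in_subtopology C_def)
    show "?g n ` topspace (subshift_topology N A) = topspace (subtopology hyperspace_topology (C n))"
      using C_sub[of n] by (auto simp: hyperspace_topology_def C_def)
    show "inj_on (?g n) (topspace (subshift_topology N A))"
      using g_inj by simp
  qed
  define h where "h n = inv_into ?S (?g n)" for n
  have hg: "h n (?g n \<alpha>) = \<alpha>" if "\<alpha> \<in> ?S" for n \<alpha>
    unfolding h_def by (rule inv_into_f_f[OF g_inj that])
  have step_g: "induced_map f n (?g n \<alpha>) = ?g (Suc n) (shift \<alpha>)" if "\<alpha> \<in> ?S" for n \<alpha>
    using step[OF that] by (simp add: induced_map_def)
  have h_homeo: "homeomorphic_map (subtopology hyperspace_topology (C n)) (subshift_topology N A) (h n)"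
    for n
  proof -
    \<comment> \<open>The inverse \<open>h'\<close> supplied here is determined only on
      \<open>C n\<close>; there it agrees with \<open>h n\<close>, which suffices to transfer the
      homeomorphism property.\<close>
    obtain h' where h': "homeomorphic_maps (subshift_topology N A)
        (subtopology hyperspace_topology (C n)) (?g n) h'"
      using homeo homeomorphic_map_maps by blast
    then have "homeomorphic_map (subtopology hyperspace_topology (C n)) (subshift_topology N A) h'"
      using homeomorphic_maps_map by blast
    moreover have "h' B = h n B" if "B \<in> topspace (subtopology hyperspace_topology (C n))" for B
      using that h' hg by (auto simp: homeomorphic_maps_def C_def)
    ultimately show ?thesis
      using homeomorphic_map_eq by blast
  qed
  have image: "induced_map f n ` C n = C (Suc n)" for n
  proof -
    have "induced_map f n ` C n = (\<lambda>\<alpha>. ?g (Suc n) (shift \<alpha>)) ` ?S"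
      unfolding C_def image_image using step_g by (intro image_cong) auto
    also have "\<dots> = C (Suc n)"
      \<comment> \<open>Only the \<open>?S\<close> on the right is rewritten as its own image under
        \<open>shift\<close>.\<close>
      unfolding C_def by (subst (2) shift_image_subshift[OF A, symmetric]) (simp add: image_image)
    finally show ?thesis .
  qed
  show ?thesis
  proof (intro exI[of _ C] conjI allI)
    fix n
    show "C n \<noteq> {}"
      using subshift_nonempty[OF A] by (simp add: C_def)
    show "compactin hyperspace_topology (C n)"
      using image_compactin[OF _ cont] compact_space_subshift_topology[of N A]
      unfolding C_def compact_space_def by simp
    show "C n \<subseteq> (\<Union>i\<in>{1..N}. hyper_below (V i n))"
    proof
      fix B assume "B \<in> C n"
      then obtain \<alpha> where \<alpha>: "\<alpha> \<in> ?S" "B = ?g n \<alpha>"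
        by (auto simp: C_def)
      then have "B \<in> hyper_below (V (\<alpha> 0) n)"
        \<comment> \<open>At \<open>k = 0\<close> the iterate is the identity, so the point itself
          lies in the set of the first symbol.\<close>
        using orbit[of \<alpha> n 0] by (simp add: hyper_below_def)
      then show "B \<in> (\<Union>i\<in>{1..N}. hyper_below (V i n))"
        using sym[OF \<alpha>(1)] by blast
    qed
    show "induced_map f n ` C n = C (Suc n)"
      by (rule image)
  next
    show "invariant_subsystem f C"
      unfolding invariant_subsystem_def using C_sub image by auto
    show "conjugate_to_subshift f C N A"
      unfolding conjugate_to_subshift_def
    proof (intro exI[of _ h] allI conjI ballI h_homeo)
      fix n B assume "B \<in> C n"
      then obtain \<alpha> where \<alpha>: "\<alpha> \<in> ?S" "B = ?g n \<alpha>"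
        by (auto simp: C_def)
      then show "h (Suc n) (induced_map f n B) = shift (h n B)"
        \<comment> \<open>On \<open>{x n \<alpha>}\<close> both sides evaluate to
          \<open>shift \<alpha>\<close>.\<close>
        by (simp only: step_g hg shift_in)
    qed
  qed
qed

end
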